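(* Let $\mu$ be a directed metric on a finite set $T$. Suppose that the underlying graph $H_\mu$ is the covering graph of a modular lattice $\mathcal{L}$ with ground set $T$, and that $\mu$ is directed orbit-invariant. Then the function $\mu:\mathcal{L}\times\mathcal{L}\to\mathbb{R}_+$ is submodular on the product lattice $\mathcal{L}\times\mathcal{L}$, i.e. $\mu(a)+\mu(b)\ge\mu(a\vee b)+\mu(a\wedge b)$ for all $a,b\in\mathcal{L}\times\mathcal{L}$.
   Context: A directed metric on a finite set $T$ is a function $\mu:T\times T\to\mathbb{R}_+$ with $\mu(x,x)=0$, $\mu(x,y)+\mu(y,z)\ge\mu(x,z)$ for all $x,y,z\in T$, and $\mu(x,y)+\mu(y,x)>0$ for all $x\ne y$. The underlying graph $H_\mu=(T,U)$ is the undirected graph whose edges are the unordered pairs $xy$ of distinct elements such that either $\mu(x,y)<\mu(x,z)+\mu(z,y)$ for all $z\in T\setminus\{x,y\}$, or $\mu(y,x)<\mu(y,z)+\mu(z,x)$ for all $z\in T\setminus\{x,y\}$. A lattice is modular if $a\vee(b\wedge c)=(a\vee b)\wedge c$ whenever $a\preceq c$; its covering graph joins $a,b$ whenever one covers the other. $\mathcal{L}\times\mathcal{L}$ carries the componentwise order $(a,b)\preceq(c,d)$ iff $a\preceq c$ and $b\preceq d$, with componentwise join and meet. For an undirected graph $G$, an oriented edge is an ordered pair $(u,v)$ with $uv$ an edge; oriented edges $e,e'$ are projective if there is a sequence $e=(p_0,q_0),\dots,(p_m,q_m)=e'$ of oriented edges with $(p_i,q_i,q_{i+1},p_{i+1},p_i)$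 a 4-cycle in $G$ for each $i$; equivalence classes are directed orbits. $\mu$ is directed orbit-invariant if $\mu(u_1,u_2)=\mu(u_1',u_2')$ whenever $(u_1,u_2),(u_1',u_2')$ are oriented edges of $H_\mu$ in the same directed orbit of $H_\mu$. *)

theory Defs
  imports Complex_Main "HOL-Algebra.Lattice"
begin

text \<open>Simple undirected graphs: a vertex set and a set of edges, each a doubleton of vertices.\<close>

type_synonym 'a ugraph = "'a set \<times> 'a set set"

definition directed_metric :: "'a set \<Rightarrow> ('a \<times> 'a \<Rightarrow> real) \<Rightarrow> bool" where
  "directed_metric T \<mu> \<longleftrightarrow>
     (\<forall>x\<in>T. \<forall>y\<in>T. 0 \<le> \<mu> (x, y)) \<and>
     (\<forall>x\<in>T. \<mu> (x, x) = 0) \<and>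
     (\<forall>x\<in>T. \<forall>y\<in>T. \<forall>z\<in>T. \<mu> (x, y) + \<mu> (y, z) \<ge> \<mu> (x, z)) \<and>
     (\<forall>x\<in>T. \<forall>y\<in>T. x \<noteq> y \<longrightarrow> \<mu> (x, y) + \<mu> (y, x) > 0)"

definition underlying_graph :: "'a set \<Rightarrow> ('a \<times> 'a \<Rightarrow> real) \<Rightarrow> 'a ugraph" where
  "underlying_graph T \<mu> = (T, {{x, y} | x y. x \<in> T \<and> y \<in> T \<and> x \<noteq> y \<and>
     ((\<forall>z\<in>T - {x, y}. \<mu> (x, y) < \<mu> (x, z) + \<mu> (z, y)) \<or>
      (\<forall>z\<in>T - {x, y}. \<mu> (y, x) < \<mu> (y, z) + \<mu> (z, x)))})"

definition oriented_edges :: "'a ugraph \<Rightarrow> ('a \<times> 'a) set" where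
  "oriented_edges G = {(u, v). {u, v} \<in> snd G}"

definition four_cycle :: "'a ugraph \<Rightarrow> 'a \<Rightarrow> 'a \<Rightarrow> 'a \<Rightarrow> 'a \<Rightarrow> bool" where
  "four_cycle G a b c d \<longleftrightarrow> distinct [a, b, c, d] \<and>
     {a, b} \<in> snd G \<and> {b, c} \<in> snd G \<and> {c, d} \<in> snd G \<and> {d, a} \<in> snd G"

definition projective :: "'a ugraph \<Rightarrow> 'a \<times> 'a \<Rightarrow> 'a \<times> 'a \<Rightarrow> bool" where
  "projective G e e' \<longleftrightarrow> (\<exists>(m::nat) p q.
     (p 0, q 0) = e \<and> (p m, q m) = e' \<and>
     (\<forall>i\<le>m. (p i, q i) \<in> oriented_edges G) \<and>
     (\<forall>i<m. four_cycle G (p i) (q i) (q (Suc i)) (p (Suc i))))"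

definition directed_orbits :: "'a ugraph \<Rightarrow> ('a \<times> 'a) set set" where
  "directed_orbits G = oriented_edges G // {(e, e'). projective G e e'}"

definition directed_orbit_invariant :: "'a set \<Rightarrow> ('a \<times> 'a \<Rightarrow> real) \<Rightarrow> bool" where
  "directed_orbit_invariant T \<mu> \<longleftrightarrow>
     (\<forall>Q\<in>directed_orbits (underlying_graph T \<mu>). \<forall>e\<in>Q. \<forall>e'\<in>Q. \<mu> e = \<mu> e')"

locale modular_lattice = lattice +
  assumes modular: "\<lbrakk>a \<in> carrier L; b \<in> carrier L; c \<in> carrier L; a \<sqsubseteq> c\<rbrakk>
    \<Longrightarrow> a \<squnion> (b \<sqinter> c) = (a \<squnion> b) \<sqinter> c"

definition covers :: "('a, 'b) gorder_scheme \<Rightarrow> 'a \<Rightarrow> 'a \<Rightarrow> bool" where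
  "covers L b a \<longleftrightarrow> a \<in> carrier L \<and> b \<in> carrier L \<and> a \<sqsubset>\<^bsub>L\<^esub> b \<and>
     \<not> (\<exists>c\<in>carrier L. a \<sqsubset>\<^bsub>L\<^esub> c \<and> c \<sqsubset>\<^bsub>L\<^esub> b)"

definition covering_graph :: "('a, 'b) gorder_scheme \<Rightarrow> 'a ugraph" where
  "covering_graph L = (carrier L, {{a, b} | a b. covers L a b \<or> covers L b a})"

definition prod_order ::
  "('a, 'c) gorder_scheme \<Rightarrow> ('b, 'd) gorder_scheme \<Rightarrow> ('a \<times> 'b) gorder" where
  "prod_order L M = \<lparr>carrier = carrier L \<times> carrier M, eq = (=),
     le = (\<lambda>(a, b) (c, d). a \<sqsubseteq>\<^bsub>L\<^esub> c \<and> b \<sqsubseteq>\<^bsub>M\<^esub> d)\<rparr>"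

definition submodular_on :: "('a, 'b) gorder_scheme \<Rightarrow> ('a \<Rightarrow> real) \<Rightarrow> bool" where
  "submodular_on L f \<longleftrightarrow>
     (\<forall>a\<in>carrier L. \<forall>b\<in>carrier L. f a + f b \<ge> f (a \<squnion>\<^bsub>L\<^esub> b) + f (a \<sqinter>\<^bsub>L\<^esub> b))"

lemma four_cycle_rev:
  assumes "four_cycle G a b c d"
  shows "four_cycle G d c b a"
proof -
  have e: "{d, c} = {c, d}" "{c, b} = {b, c}" "{b, a} = {a, b}" "{a, d} = {d, a}"
    by blast+
  have "distinct (rev [a, b, c, d])"
    using assms unfolding four_cycle_def distinct_rev by (rule conjunct1)
  moreover have "{d, c} \<in> snd G" "{c, b} \<in> snd G" "{b, a} \<in> snd G" "{a, d} \<in> snd G"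
    using assms unfolding four_cycle_def e by iprover+
  ultimately show ?thesis
    unfolding four_cycle_def by simp
qed

lemma equiv_projective:
  "equiv (oriented_edges G) {(e, e'). projective G e e'}"
proof (rule equivI)
  show "{(e, e'). projective G e e'} \<subseteq> oriented_edges G \<times> oriented_edges G"
    by (auto simp: projective_def)
  show "refl_on (oriented_edges G) {(e, e'). projective G e e'}"
  proof (rule refl_onI)
    fix e assume "e \<in> oriented_edges G"
    then show "(e, e) \<in> {(e, e'). projective G e e'}"
      unfolding projective_def mem_Collect_eq case_prod_conv
      by (intro exI[of _ 0] exI[of _ "\<lambda>_. fst e"] exI[of _ "\<lambda>_. snd e"]) simp
  qed
  show "sym {(e, e'). projective G e e'}"
  proof (rule symI, clarify)
    fix a b c d assume "projective G (a, b) (c, d)"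
    then obtain m p q where h: "p 0 = a" "q 0 = b" "p m = c" "q m = d"
      "\<And>i. i \<le> m \<Longrightarrow> (p i, q i) \<in> oriented_edges G"
      "\<And>i. i < m \<Longrightarrow> four_cycle G (p i) (q i) (q (Suc i)) (p (Suc i))"
      unfolding projective_def by auto
    have "four_cycle G (p (m - i)) (q (m - i)) (q (m - Suc i)) (p (m - Suc i))" if "i < m" for i
    proof -
      have e: "Suc (m - Suc i) = m - i" using that by simp
      have "four_cycle G (p (m - Suc i)) (q (m - Suc i)) (q (m - i)) (p (m - i))"
        using h(6)[of "m - Suc i"] that unfolding e by simp
      then show ?thesis
        by (rule four_cycle_rev)
    qed
    then show "projective G (c, d) (a, b)"
      unfolding projective_def using h(1-5)
      by (intro exI[of _ m] exI[of _ "\<lambda>i. p (m - i)"] exI[of _ "\<lambda>i. q (m - i)"]) auto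
  qed
  show "trans {(e, e'). projective G e e'}"
  proof (rule transI, clarify)
    fix a b c d e f assume "projective G (a, b) (c, d)" "projective G (c, d) (e, f)"
    then obtain m p q n r s where h: "p 0 = a" "q 0 = b" "p m = c" "q m = d"
      "\<And>i. i \<le> m \<Longrightarrow> (p i, q i) \<in> oriented_edges G"
      "\<And>i. i < m \<Longrightarrow> four_cycle G (p i) (q i) (q (Suc i)) (p (Suc i))"
      and k: "r 0 = c" "s 0 = d" "r n = e" "s n = f"
      "\<And>i. i \<le> n \<Longrightarrow> (r i, s i) \<in> oriented_edges G"
      "\<And>i. i < n \<Longrightarrow> four_cycle G (r i) (s i) (s (Suc i)) (r (Suc i))"
      unfolding projective_def by auto
    define P where "P i = (if i \<le> m then p i else r (i - m))" for i
    define Q where "Q i = (if i \<le> m then q i else s (i - m))" for i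
    have end': "P (m + n) = e" "Q (m + n) = f"
      using h(3,4) k(1-4) by (auto simp: P_def Q_def)
    have ed: "(P i, Q i) \<in> oriented_edges G" if "i \<le> m + n" for i
      using h(5)[of i] k(5)[of "i - m"] that by (auto simp: P_def Q_def)
    have cyc: "four_cycle G (P i) (Q i) (Q (Suc i)) (P (Suc i))" if "i < m + n" for i
    proof (cases "i < m")
      case True
      then show ?thesis using h(6)[of i] by (auto simp: P_def Q_def)
    next
      case False
      then have "P i = r (i - m)" "Q i = s (i - m)"
        using h(3,4) k(1,2) by (auto simp: P_def Q_def not_less le_less)
      then show ?thesis using False that k(6)[of "i - m"]
        by (simp add: P_def Q_def Suc_diff_le)
    qed
    show "projective G (a, b) (e, f)"
      unfolding projective_def using h(1,2) end' ed cyc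
      by (intro exI[of _ "m + n"] exI[of _ P] exI[of _ Q]) (auto simp: P_def Q_def)
  qed
qed

lemma least_prod_order:
  assumes "lattice L" "lattice M" "a \<in> carrier L" "c \<in> carrier L" "b \<in> carrier M" "d \<in> carrier M"
  shows "least (prod_order L M) (a \<squnion>\<^bsub>L\<^esub> c, b \<squnion>\<^bsub>M\<^esub> d) (Upper (prod_order L M) {(a, b), (c, d)})"
proof -
  interpret L: lattice L by fact
  interpret M: lattice M by fact
  show ?thesis
    using assms(3-) L.join_left L.join_right L.join_le M.join_left M.join_right M.join_le
    by (auto simp: least_def Upper_def prod_order_def)
qed

lemma greatest_prod_order:
  assumes "lattice L" "lattice M" "a \<in> carrier L" "c \<in> carrier L" "b \<in> carrier M" "d \<in> carrier M"
  shows "greatest (prod_order L M) (a \<sqinter>\<^bsub>L\<^esub> c, b \<sqinter>\<^bsub>M\<^esub> d) (Lower (prod_order L M) {(a, b), (c, d)})"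
proof -
  interpret L: lattice L by fact
  interpret M: lattice M by fact
  show ?thesis
    using assms(3-) L.meet_left L.meet_right L.meet_le M.meet_left M.meet_right M.meet_le
    by (auto simp: greatest_def Lower_def prod_order_def)
qed

lemma lattice_prod_order:
  assumes "lattice L" "lattice M"
  shows "lattice (prod_order L M)"
proof -
  interpret L: lattice L by fact
  interpret M: lattice M by fact
  interpret partial_order "prod_order L M"
    by unfold_locales
      (auto simp: prod_order_def intro: L.le_antisym M.le_antisym L.le_trans M.le_trans)
  show ?thesis
  proof unfold_locales
    fix x y assume "x \<in> carrier (prod_order L M)" "y \<in> carrier (prod_order L M)"
    then obtain a b c d where xy: "x = (a, b)" "y = (c, d)"
      and m: "a \<in> carrier L" "c \<in> carrier L" "b \<in> carrier M" "d \<in> carrier M"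
      by (auto simp: prod_order_def)
    show "\<exists>s. least (prod_order L M) s (Upper (prod_order L M) {x, y})"
      "\<exists>s. greatest (prod_order L M) s (Lower (prod_order L M) {x, y})"
      unfolding xy
      by (rule exI, rule least_prod_order[OF assms m])
        (rule exI, rule greatest_prod_order[OF assms m])
  qed
qed

lemma join_prod_order:
  assumes "lattice L" "lattice M" "a \<in> carrier L" "c \<in> carrier L" "b \<in> carrier M" "d \<in> carrier M"
  shows "(a, b) \<squnion>\<^bsub>prod_order L M\<^esub> (c, d) = (a \<squnion>\<^bsub>L\<^esub> c, b \<squnion>\<^bsub>M\<^esub> d)"
proof -
  interpret P: lattice "prod_order L M" by (rule lattice_prod_order) fact+
  show ?thesis
    using least_prod_order[OF assms] P.least_unique unfolding join_def sup_def by blast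
qed

lemma meet_prod_order:
  assumes "lattice L" "lattice M" "a \<in> carrier L" "c \<in> carrier L" "b \<in> carrier M" "d \<in> carrier M"
  shows "(a, b) \<sqinter>\<^bsub>prod_order L M\<^esub> (c, d) = (a \<sqinter>\<^bsub>L\<^esub> c, b \<sqinter>\<^bsub>M\<^esub> d)"
proof -
  interpret P: lattice "prod_order L M" by (rule lattice_prod_order) fact+
  show ?thesis
    using greatest_prod_order[OF assms] P.greatest_unique unfolding meet_def inf_def by blast
qed

end

theory Submission
  imports Defs
begin

text \<open>
  Projectivity makes the upward weights \<open>\<mu> (a, b)\<close> and the downward weights \<open>\<mu> (b, a)\<close> of covering
  pairs \<open>a \<prec> b\<close> constant along opposite sides of the diamonds of the lattice. Hence they
  are the increments of two monotone modular valuations \<open>u\<close> and \<open>d\<close>. Put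
  \<open>F x y = (u (x \<squnion> y) - u x) + (d (x \<squnion> y) - d y)\<close>, the length of a path that climbs from \<open>x\<close> to
  \<open>x \<squnion> y\<close> and then descends to \<open>y\<close>. Then \<open>\<mu> \<le> F\<close> by the triangle inequality. Conversely \<open>F\<close>
  satisfies the triangle inequality and agrees with \<open>\<mu>\<close> on edges, while every \<open>\<mu> (x, y)\<close> is the
  length of some path in the underlying graph, so \<open>F \<le> \<mu>\<close>. Finally, the submodularity of
  \<open>F = \<mu>\<close> follows from that of \<open>(x, y) \<mapsto> (u + d) (x \<squnion> y)\<close>.
\<close>

section \<open>Covers in finite lattices\<close>

context partial_order
begin

lemma covers_iff:
  "covers L b a \<longleftrightarrow> a \<in> carrier L \<and> b \<in> carrier L \<and> a \<sqsubseteq> b \<and> a \<noteq> b \<and>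
     (\<forall>c\<in>carrier L. a \<sqsubseteq> c \<longrightarrow> c \<sqsubseteq> b \<longrightarrow> c = a \<or> c = b)"
  unfolding covers_def lless_eq by blast

lemma card_down_set_less:
  assumes "finite (carrier L)" "a \<in> carrier L" "b \<in> carrier L" "a \<sqsubseteq> b" "a \<noteq> b"
  shows "card {x \<in> carrier L. x \<sqsubseteq> a} < card {x \<in> carrier L. x \<sqsubseteq> b}"
proof (rule psubset_card_mono)
  show "finite {x \<in> carrier L. x \<sqsubseteq> b}" using assms(1) by simp
  have "b \<notin> {x \<in> carrier L. x \<sqsubseteq> a}" "b \<in> {x \<in> carrier L. x \<sqsubseteq> b}"
    using assms le_antisym by auto
  moreover have "{x \<in> carrier L. x \<sqsubseteq> a} \<subseteq> {x \<in> carrier L. x \<sqsubseteq> b}"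
    using assms le_trans by blast
  ultimately show "{x \<in> carrier L. x \<sqsubseteq> a} \<subset> {x \<in> carrier L. x \<sqsubseteq> b}" by blast
qed

text \<open>Among the elements of the interval from \<open>a\<close> to \<open>b\<close> other than
  \<open>b\<close>, take one whose principal down-set is largest. Anything strictly between it and
  \<open>b\<close> would have a larger down-set.\<close>

lemma ex_lower_cover:
  assumes fin: "finite (carrier L)" and a: "a \<in> carrier L" and b: "b \<in> carrier L"
    and ab: "a \<sqsubseteq> b" "a \<noteq> b"
  shows "\<exists>c. covers L b c \<and> a \<sqsubseteq> c"
proof -
  let ?P = "\<lambda>c. c \<in> carrier L \<and> a \<sqsubseteq> c \<and> c \<sqsubseteq> b \<and> c \<noteq> b"
  let ?f = "\<lambda>c. card {x \<in> carrier L. x \<sqsubseteq> c}"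
  have "?P a" using a ab by simp
  moreover have "\<forall>c. ?P c \<longrightarrow> ?f c < Suc (card (carrier L))"
    using fin by (auto simp: less_Suc_eq_le intro!: card_mono)
  ultimately obtain c where c: "?P c" and max: "\<And>e. ?P e \<Longrightarrow> ?f e \<le> ?f c"
    using ex_has_greatest_nat[of ?P a ?f "Suc (card (carrier L))"] by blast
  have "e = c \<or> e = b" if "e \<in> carrier L" "c \<sqsubseteq> e" "e \<sqsubseteq> b" for e
  proof (rule ccontr)
    assume "\<not> (e = c \<or> e = b)"
    moreover from this have "?f c < ?f e"
      using card_down_set_less[OF fin, of c e] c that by auto
    moreover have "a \<sqsubseteq> e" using le_trans[of a c e] a c that by blast
    ultimately show False using max[of e] that by auto
  qed
  then show ?thesis using c b unfolding covers_iff by blast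
qed

text \<open>Induction up a maximal chain of the interval, found by descending from \<open>b\<close>
  through lower covers that stay above \<open>a\<close>. The step keeps both bounds because the
  valuation identity needs them.\<close>

lemma le_covers_induct [consumes 4, case_names base step]:
  assumes fin: "finite (carrier L)" and "a \<in> carrier L" "b \<in> carrier L" "a \<sqsubseteq> b"
    and base: "P a"
    and step: "\<And>c e. \<lbrakk>covers L e c; a \<sqsubseteq> c; e \<sqsubseteq> b; P c\<rbrakk> \<Longrightarrow> P e"
  shows "P b"
proof -
  have "P x" if "x \<in> carrier L" "a \<sqsubseteq> x" "x \<sqsubseteq> b" for x
    using that
  proof (induction "card {y \<in> carrier L. y \<sqsubseteq> x}" arbitrary: x rule: less_induct)
    case less
    show ?case
    proof (cases "x = a")
      case False
      then obtain c where c: "covers L x c" "a \<sqsubseteq> c"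
        using ex_lower_cover[OF fin assms(2) less.prems(1,2)] by auto
      then have c': "c \<in> carrier L" "c \<sqsubseteq> x" "c \<noteq> x" unfolding covers_iff by auto
      then have "c \<sqsubseteq> b" using le_trans[of c x b] less.prems assms(3) by blast
      then have "P c"
        using less.hyps[OF card_down_set_less[OF fin c'(1) less.prems(1) c'(2,3)] c'(1) c(2)]
        by blast
      then show ?thesis using step c less.prems by blast
    qed (use base in simp)
  qed
  then show ?thesis using assms by blast
qed

end

lemma (in upper_semilattice) le_joinI1:
  assumes "a \<sqsubseteq> b" "a \<in> carrier L" "b \<in> carrier L" "c \<in> carrier L"
  shows "a \<sqsubseteq> b \<squnion> c"
  using assms le_trans[of a b "b \<squnion> c"] join_left by simp

lemma (in upper_semilattice) le_joinI2:
  assumes "a \<sqsubseteq> c" "a \<in> carrier L" "b \<in> carrier L" "c \<in> carrier L"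
  shows "a \<sqsubseteq> b \<squnion> c"
  using le_joinI1[of a c b] assms join_comm by metis

section \<open>Transposing covers in modular lattices\<close>

context modular_lattice
begin

text \<open>For \<open>t\<close> between \<open>s\<close> and \<open>r \<squnion> s\<close>, the
  meet \<open>r \<sqinter> t\<close> lies in the two-element interval from
  \<open>r \<sqinter> s\<close> to \<open>r\<close>. The upper value forces \<open>t\<close> above
  \<open>r\<close>; at the lower value modularity collapses \<open>t\<close> to
  \<open>s\<close>.\<close>

lemma covers_join_if_covers_meet:
  assumes "covers L r (r \<sqinter> s)" "r \<in> carrier L" "s \<in> carrier L"
  shows "covers L (r \<squnion> s) s"
proof -
  have "r \<sqinter> s \<noteq> r" using assms unfolding covers_iff by blast
  then have ne: "s \<noteq> r \<squnion> s"
    using assms(2,3) join_left le_iff_join by metis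
  have "t = s \<or> t = r \<squnion> s" if t: "t \<in> carrier L" "s \<sqsubseteq> t" "t \<sqsubseteq> r \<squnion> s" for t
  proof -
    have "r \<sqinter> s \<sqsubseteq> r \<sqinter> t"
      using assms t by (meson le_trans meet_closed meet_le meet_left meet_right)
    then have "r \<sqinter> t = r \<sqinter> s \<or> r \<sqinter> t = r"
      using assms t meet_left[of r t] unfolding covers_iff by auto
    then show ?thesis
    proof
      assume "r \<sqinter> t = r"
      then have "r \<squnion> s \<sqsubseteq> t" using assms t le_iff_join join_le by metis
      then show ?thesis using t assms by (blast intro: le_antisym join_closed)
    next
      assume rt: "r \<sqinter> t = r \<sqinter> s"
      have "t = (s \<squnion> r) \<sqinter> t"
        using t assms le_iff_join join_comm meet_comm join_closed by metis
      also have "\<dots> = s \<squnion> (r \<sqinter> s)" using modular[of s r t] t assms rt by simp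
      also have "\<dots> = s"
        using assms by (intro le_antisym join_le join_left meet_right) auto
      finally show ?thesis by simp
    qed
  qed
  then show ?thesis
    using ne assms join_right unfolding covers_iff by (simp add: join_right)
qed

lemma meet_eq_if_covers:
  assumes "covers L r p" "q \<in> carrier L" "p \<sqsubseteq> q" "\<not> r \<sqsubseteq> q"
  shows "r \<sqinter> q = p"
proof -
  have "r \<in> carrier L" "p \<in> carrier L" "p \<sqsubseteq> r" using assms unfolding covers_iff by auto
  then have "p \<sqsubseteq> r \<sqinter> q" "r \<sqinter> q \<sqsubseteq> r" "r \<sqinter> q \<noteq> r"
    using assms meet_le meet_left le_iff_join by metis+
  then show ?thesis using assms unfolding covers_iff by auto
qed

text \<open>Dual argument: for \<open>x\<close> between \<open>r \<sqinter> s\<close> and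
  \<open>r\<close>, the join \<open>x \<squnion> s\<close> is \<open>s\<close> or \<open>t\<close>,
  and modularity recovers \<open>x\<close> as \<open>(x \<squnion> s) \<sqinter> r\<close>.\<close>

lemma covers_meet_if_covers_join:
  assumes r: "covers L t r" and s: "covers L t s" and rs: "r \<noteq> s"
  shows "covers L r (r \<sqinter> s)"
proof -
  have c: "t \<in> carrier L" "r \<in> carrier L" "s \<in> carrier L" "r \<sqsubseteq> t" "s \<sqsubseteq> t"
    using assms unfolding covers_iff by auto
  have nle: "\<not> r \<sqsubseteq> s" using r s rs c unfolding covers_iff by blast
  have "x = r \<sqinter> s \<or> x = r" if x: "x \<in> carrier L" "r \<sqinter> s \<sqsubseteq> x" "x \<sqsubseteq> r" for x
  proof -
    have xs: "x \<squnion> s \<in> carrier L" "s \<sqsubseteq> x \<squnion> s" "x \<squnion> s \<sqsubseteq> t"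
      using x c join_right join_le le_trans[of x r t] by auto
    then have "x \<squnion> s = s \<or> x \<squnion> s = t" using s unfolding covers_iff by blast
    moreover have m: "x \<squnion> (s \<sqinter> r) = (x \<squnion> s) \<sqinter> r" using modular x c by blast
    moreover have "x \<squnion> (s \<sqinter> r) = x"
      using x c by (intro le_antisym join_le join_left) (auto simp: meet_comm)
    moreover have "t \<sqinter> r = r" using c le_iff_join meet_comm by metis
    ultimately show ?thesis using meet_comm by metis
  qed
  moreover have "r \<sqinter> s \<noteq> r" using nle c meet_right by metis
  ultimately show ?thesis using c meet_left unfolding covers_iff by auto
qed

lemma covers_join_if_upper_covers:
  assumes "covers L r p" "covers L s p" "r \<noteq> s"
  shows "covers L (r \<squnion> s) s" "r \<sqinter> s = p"
proof -
  have c: "r \<in> carrier L" "s \<in> carrier L" "p \<sqsubseteq> s" "p \<sqsubseteq> r" "r \<noteq> p"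
    using assms unfolding covers_iff by auto
  then have "\<not> r \<sqsubseteq> s" using assms unfolding covers_iff by blast
  then show "r \<sqinter> s = p" using meet_eq_if_covers assms c by blast
  then show "covers L (r \<squnion> s) s" using covers_join_if_covers_meet assms c by simp
qed

section \<open>Valuations from weights on covers\<close>

text \<open>While a maximal chain climbs from \<open>a\<close> to \<open>q\<close>, the cover of
  \<open>a\<close> by \<open>b\<close> is carried across one diamond per step, and each diamond
  preserves the increment of \<open>u\<close>.\<close>

lemma diamond_modular_transpose:
  fixes u :: "'a \<Rightarrow> real"
  assumes fin: "finite (carrier L)"
    and diamond: "\<And>p r s. \<lbrakk>covers L r p; covers L s p; r \<noteq> s\<rbrakk> \<Longrightarrow> u r + u s = u p + u (r \<squnion> s)"
    and ba: "covers L b a" and q: "q \<in> carrier L" and aq: "a \<sqsubseteq> q" and bq: "\<not> b \<sqsubseteq> q"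
  shows "u b - u a = u (b \<squnion> q) - u q"
proof -
  have c: "a \<in> carrier L" "b \<in> carrier L" "a \<sqsubseteq> b" using ba unfolding covers_iff by auto
  from fin c(1) q aq
  \<comment> \<open>The covering claim joins the induction because it supplies one side of the next
    diamond. The condition on \<open>b\<close> sits inside the formula since it passes from each
    chain element to those below.\<close>
  have "\<not> b \<sqsubseteq> q \<longrightarrow> covers L (b \<squnion> q) q \<and> u b - u a = u (b \<squnion> q) - u q"
  proof (induction rule: le_covers_induct)
    case base
    have "b \<squnion> a = b" using c by (intro le_antisym join_le join_left) auto
    then show ?case using ba by simp
  next
    case (step e f)
    show ?case
    proof
      assume bf: "\<not> b \<sqsubseteq> f"
      have ef: "e \<in> carrier L" "f \<in> carrier L" "e \<sqsubseteq> f" using step unfolding covers_iff by auto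
      have be: "\<not> b \<sqsubseteq> e" using bf le_trans[of b e f] ef c by blast
      have IH: "covers L (b \<squnion> e) e" "u b - u a = u (b \<squnion> e) - u e" using step be by auto
      have ne: "b \<squnion> e \<noteq> f" using bf join_left c ef by blast
      have eq: "(b \<squnion> e) \<squnion> f = b \<squnion> f"
      proof (rule le_antisym)
        show "b \<squnion> e \<squnion> f \<sqsubseteq> b \<squnion> f"
          using c ef le_trans[of e f "b \<squnion> f"] by (intro join_le join_left) (auto simp: join_right)
        show "b \<squnion> f \<sqsubseteq> b \<squnion> e \<squnion> f"
          using c ef le_trans[of b "b \<squnion> e" "b \<squnion> e \<squnion> f"]
          by (intro join_le join_right) (auto simp: join_left)
      qed (use c ef in auto)
      have "covers L (b \<squnion> f) f"
        using covers_join_if_upper_covers(1)[OF IH(1) step(1) ne] eq by simp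
      moreover have "u (b \<squnion> e) + u f = u e + u (b \<squnion> f)"
        using diamond[OF IH(1) step(1) ne] eq by simp
      ultimately show "covers L (b \<squnion> f) f \<and> u b - u a = u (b \<squnion> f) - u f" using IH by simp
    qed
  qed
  then show ?thesis using bq by blast
qed

text \<open>Along a maximal chain from \<open>x \<sqinter> y\<close> to \<open>y\<close>, joining
  with \<open>x\<close> transposes every cover to one with the same increment, so
  \<open>u (x \<squnion> c) - u c\<close> stays constant.\<close>

lemma modular_valuation_if_diamond_modular:
  fixes u :: "'a \<Rightarrow> real"
  assumes fin: "finite (carrier L)"
    and diamond: "\<And>p r s. \<lbrakk>covers L r p; covers L s p; r \<noteq> s\<rbrakk> \<Longrightarrow> u r + u s = u p + u (r \<squnion> s)"
    and x: "x \<in> carrier L" and y: "y \<in> carrier L"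
  shows "u x + u y = u (x \<squnion> y) + u (x \<sqinter> y)"
proof -
  define m where "m = x \<sqinter> y"
  have m: "m \<in> carrier L" "m \<sqsubseteq> x" "m \<sqsubseteq> y"
    using x y meet_left meet_right unfolding m_def by auto
  from fin m(1) y m(3)
  have "u (x \<squnion> y) - u y = u x - u m"
  proof (induction rule: le_covers_induct)
    case base
    have "x \<squnion> m = x" using x m by (intro le_antisym join_le join_left) auto
    then show ?case by simp
  next
    case (step c e)
    have ce: "c \<in> carrier L" "e \<in> carrier L" "c \<sqsubseteq> e" "c \<noteq> e"
      using step unfolding covers_iff by auto
    \<comment> \<open>Transposition must not degenerate: otherwise modularity gives
      \<open>e = c \<squnion> (x \<sqinter> e)\<close>, and \<open>x \<sqinter> e\<close> is below
      \<open>x \<sqinter> y\<close>, hence below \<open>c\<close>.\<close>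
    have ne: "\<not> e \<sqsubseteq> x \<squnion> c"
    proof
      assume "e \<sqsubseteq> x \<squnion> c"
      then have "e = (c \<squnion> x) \<sqinter> e"
        using ce x le_iff_join join_comm meet_comm join_closed by metis
      also have "\<dots> = c \<squnion> (x \<sqinter> e)" using modular ce x by simp
      also have "\<dots> \<sqsubseteq> c"
      proof (rule join_le)
        have "x \<sqinter> e \<sqsubseteq> m"
          unfolding m_def using x y ce step(3) le_trans[of "x \<sqinter> e" e y]
          by (intro meet_le meet_left) (auto simp: meet_right)
        then show "x \<sqinter> e \<sqsubseteq> c" using le_trans[of "x \<sqinter> e" m c] step(2) x m ce by auto
      qed (use ce x in auto)
      finally show False using ce le_antisym by blast
    qed
    have "u e - u c = u (e \<squnion> (x \<squnion> c)) - u (x \<squnion> c)"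
      using diamond_modular_transpose[OF fin diamond step(1) _ _ ne] x ce join_right by auto
    moreover have "e \<squnion> (x \<squnion> c) = x \<squnion> e"
    proof (rule le_antisym)
      show "e \<squnion> (x \<squnion> c) \<sqsubseteq> x \<squnion> e"
        using x ce le_trans[of c e "x \<squnion> e"] by (intro join_le join_left) (auto simp: join_right)
      show "x \<squnion> e \<sqsubseteq> e \<squnion> (x \<squnion> c)"
        using x ce le_trans[of x "x \<squnion> c" "e \<squnion> (x \<squnion> c)"]
        by (intro join_le join_left) (auto simp: join_left join_right)
    qed (use x ce in auto)
    ultimately show ?case using step by simp
  qed
  then show ?thesis unfolding m_def by simp
qed

end

text \<open>A relation rather than a function, because the sum of weights may a priori depend on the
  maximal chain chosen from \<open>z\<close>.\<close>

inductive chain_weight ::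
  "('a, 'b) gorder_scheme \<Rightarrow> ('a \<Rightarrow> 'a \<Rightarrow> real) \<Rightarrow> 'a \<Rightarrow> 'a \<Rightarrow> real \<Rightarrow> bool"
  for L w z where
  refl: "chain_weight L w z z 0"
| step: "\<lbrakk>chain_weight L w z a r; covers L b a\<rbrakk> \<Longrightarrow> chain_weight L w z b (r + w a b)"

context modular_lattice
begin

text \<open>A potential in the style of Jordan-Hoelder: total weight from the bottom does not depend
  on the chain, since chains can be exchanged across diamonds.\<close>

lemma ex_valuation_if_diamond_invariant:
  fixes w :: "'a \<Rightarrow> 'a \<Rightarrow> real"
  assumes fin: "finite (carrier L)"
    and diamond: "\<And>p r s. \<lbrakk>covers L r p; covers L s p; r \<noteq> s\<rbrakk> \<Longrightarrow> w p r = w s (r \<squnion> s)"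
  obtains u where "\<And>a b. covers L b a \<Longrightarrow> u b = u a + w a b"
    and "\<And>x y. \<lbrakk>x \<in> carrier L; y \<in> carrier L\<rbrakk> \<Longrightarrow> u x + u y = u (x \<squnion> y) + u (x \<sqinter> y)"
proof -
  define z where "z = \<Sqinter>(carrier L)"
  \<comment> \<open>The premise on \<open>x\<close> supplies the nonempty carrier that the infimum
    requires.\<close>
  have zc: "z \<in> carrier L" and zle: "z \<sqsubseteq> x" if "x \<in> carrier L" for x
    using finite_inf_greatest[OF fin subset_refl] that
    unfolding z_def greatest_def Lower_def by auto
  have ex: "\<exists>r. chain_weight L w z x r" if x: "x \<in> carrier L" for x
    using fin zc[OF x] x zle[OF x]
  proof (induction rule: le_covers_induct)
    case base
    show ?case by (rule exI, rule chain_weight.refl)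
  next
    case (step c e)
    then obtain r where "chain_weight L w z c r" by blast
    from chain_weight.step[OF this step(1)] show ?case by (rule exI)
  qed
  have uniq: "r = s" if "x \<in> carrier L" "chain_weight L w z x r" "chain_weight L w z x s" for x r s
    using that
  proof (induction "card {y \<in> carrier L. y \<sqsubseteq> x}" arbitrary: x r s rule: less_induct)
    case less
    have IH: "r' = s'" if "covers L x c" "chain_weight L w z c r'" "chain_weight L w z c s'"
      for c r' s'
      using less.hyps[OF card_down_set_less[OF fin, of c x]] that unfolding covers_iff by blast
    \<comment> \<open>The bottom has no lower cover, so a chain ending there is the empty
      one.\<close>
    have nz: "\<not> covers L z c" for c
      using zle le_antisym unfolding covers_iff by blast
    from less.prems(2) show ?case
    proof cases
      case refl
      with less.prems(3) nz show ?thesis by (cases rule: chain_weight.cases) auto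
    next
      case (step a r1)
      note a = this
      from less.prems(3) show ?thesis
      proof cases
        case refl
        with a nz show ?thesis by auto
      next
        case (step b s1)
        show ?thesis
        proof (cases "a = b")
          case True
          then show ?thesis using IH a step by auto
        next
          case False
          \<comment> \<open>Compare both chains with a third one through
            \<open>a \<sqinter> b\<close>, of weight \<open>t\<close> there. By the induction
            hypothesis at \<open>a\<close> and \<open>b\<close> and the two diamond equations, both
            totals equal \<open>t + w a x + w b x\<close>.\<close>
          let ?m = "a \<sqinter> b"
          have ma: "covers L a ?m" and mb: "covers L b ?m"
            using covers_meet_if_covers_join a step False meet_comm by metis+
          then have "?m \<in> carrier L" unfolding covers_iff by blast
          then obtain t where t: "chain_weight L w z ?m t" using ex by blast
          have r1: "r1 = t + w ?m a" and s1: "s1 = t + w ?m b"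
            using IH[OF a(3,2) chain_weight.step[OF t ma]]
              IH[OF step(3,2) chain_weight.step[OF t mb]] by auto
          have cs: "a \<in> carrier L" "b \<in> carrier L" "a \<sqsubseteq> x" "b \<sqsubseteq> x" "x \<in> carrier L"
            using a step unfolding covers_iff by auto
          have "a \<squnion> b \<sqsubseteq> x" "b \<sqsubseteq> a \<squnion> b" "a \<squnion> b \<noteq> b"
            using cs join_le join_right covers_join_if_upper_covers(1)[OF ma mb False]
            unfolding covers_iff by auto
          then have "a \<squnion> b = x" using step(3) cs join_closed unfolding covers_iff by blast
          then show ?thesis
            using diamond[OF ma mb False] diamond[OF mb ma] False a step r1 s1 join_comm[of L a b]
            by simp
        qed
      qed
    qed
  qed
  define u where "u x = (THE r. chain_weight L w z x r)" for x
  have u: "chain_weight L w z x (u x)" if "x \<in> carrier L" for x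
    unfolding u_def using ex[OF that] uniq[OF that] by (metis theI)
  have incr: "u b = u a + w a b" if ba: "covers L b a" for a b
  proof -
    have "a \<in> carrier L" "b \<in> carrier L" using ba unfolding covers_iff by auto
    then show ?thesis using uniq[OF _ u chain_weight.step[OF u ba]] by simp
  qed
  have "u r + u s = u p + u (r \<squnion> s)" if "covers L r p" "covers L s p" "r \<noteq> s" for p r s
    using incr[OF that(1)] incr[OF covers_join_if_upper_covers(1)[OF that]] diamond[OF that]
    by simp
  then show thesis
    using that incr modular_valuation_if_diamond_modular[OF fin] by blast
qed

lemma valuation_mono:
  fixes u :: "'a \<Rightarrow> real"
  assumes "finite (carrier L)" "\<And>a b. covers L b a \<Longrightarrow> u a \<le> u b"
    and "x \<in> carrier L" "y \<in> carrier L" "x \<sqsubseteq> y"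
  shows "u x \<le> u y"
  using assms(1,3-5)
proof (induction rule: le_covers_induct)
  case (step c e)
  then show ?case using assms(2)[of e c] by simp
qed simp

text \<open>The bounds \<open>p \<sqsubseteq> a \<squnion> b\<close> and \<open>q \<sqsubseteq> a \<sqinter> b\<close> are left free so that the triangle inequality and the
  submodularity of the path length are both instances.\<close>

lemma valuation_sum_le:
  fixes v :: "'a \<Rightarrow> real"
  assumes mono: "\<And>x y. \<lbrakk>x \<in> carrier L; y \<in> carrier L; x \<sqsubseteq> y\<rbrakk> \<Longrightarrow> v x \<le> v y"
    and modv: "\<And>x y. \<lbrakk>x \<in> carrier L; y \<in> carrier L\<rbrakk> \<Longrightarrow> v x + v y = v (x \<squnion> y) + v (x \<sqinter> y)"
    and "a \<in> carrier L" "b \<in> carrier L" "p \<in> carrier L" "q \<in> carrier L"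
    and "p \<sqsubseteq> a \<squnion> b" "q \<sqsubseteq> a" "q \<sqsubseteq> b"
  shows "v p + v q \<le> v a + v b"
  using assms(3-) mono[of p "a \<squnion> b"] mono[of q "a \<sqinter> b"] modv[of a b] meet_le by auto

end

section \<open>Directed metrics\<close>

text \<open>Splits a pair at intermediate points of shortest paths until only edges remain. The
  measure counts the points \<open>t\<close> with equality in the triangle inequality; the distance
  itself need not drop, as a one-way distance may be 0.\<close>

lemma underlying_graph_induct [consumes 4, case_names refl edge split]:
  assumes fin: "finite T" and met: "directed_metric T \<mu>" and "x \<in> T" "y \<in> T"
    and refl: "\<And>x. x \<in> T \<Longrightarrow> P x x"
    and edge: "\<And>x y. {x, y} \<in> snd (underlying_graph T \<mu>) \<Longrightarrow> P x y"
    and split: "\<And>x y z. \<lbrakk>x \<in> T; y \<in> T; z \<in> T; \<mu> (x, y) = \<mu> (x, z) + \<mu> (z, y); P x z; P z y\<rbrakk> \<Longrightarrow> P x y"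
  shows "P x y"
  using assms(3,4)
proof (induction "card {t \<in> T. \<mu> (x, t) + \<mu> (t, y) = \<mu> (x, y)}" arbitrary: x y rule: less_induct)
  case less
  let ?I = "\<lambda>x y. {t \<in> T. \<mu> (x, t) + \<mu> (t, y) = \<mu> (x, y)}"
  have tri: "\<mu> (a, c) \<le> \<mu> (a, b) + \<mu> (b, c)" if "a \<in> T" "b \<in> T" "c \<in> T" for a b c
    using met that unfolding directed_metric_def by blast
  have pos: "\<mu> (a, b) + \<mu> (b, a) > 0" if "a \<in> T" "b \<in> T" "a \<noteq> b" for a b
    using met that unfolding directed_metric_def by blast
  have zero: "\<mu> (a, a) = 0" if "a \<in> T" for a
    using met that unfolding directed_metric_def by blast
  show ?case
  proof (cases "x = y \<or> {x, y} \<in> snd (underlying_graph T \<mu>)")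
    case True
    then show ?thesis using refl edge less.prems by blast
  next
    case False
    then have "\<not> (\<forall>z\<in>T - {x, y}. \<mu> (x, y) < \<mu> (x, z) + \<mu> (z, y))"
      using less.prems unfolding underlying_graph_def by auto
    then obtain z where z: "z \<in> T" "z \<noteq> x" "z \<noteq> y" "\<mu> (x, z) + \<mu> (z, y) \<le> \<mu> (x, y)"
      by (auto simp: not_less)
    then have eq: "\<mu> (x, y) = \<mu> (x, z) + \<mu> (z, y)" using tri[of x z y] less.prems by simp
    have "?I x z \<subset> ?I x y"
    proof
      show "?I x z \<subseteq> ?I x y"
      proof
        fix t assume "t \<in> ?I x z"
        then show "t \<in> ?I x y"
          using tri[of t z y] tri[of x t y] less.prems z(1) eq by auto
      qed
      have "y \<in> ?I x y" using zero less.prems by simp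
      \<comment> \<open>If \<open>y\<close> lay on a shortest path from \<open>x\<close> to
        \<open>z\<close>, then \<open>\<mu> (z, y) + \<mu> (y, z)\<close> would vanish.\<close>
      moreover have "y \<notin> ?I x z" using pos[of z y] z less.prems eq by auto
      ultimately show "?I x z \<noteq> ?I x y" by blast
    qed
    then have 1: "P x z" using less.hyps[of x z] less.prems z fin by (simp add: psubset_card_mono)
    have "?I z y \<subset> ?I x y"
    proof
      show "?I z y \<subseteq> ?I x y"
      proof
        fix t assume "t \<in> ?I z y"
        then show "t \<in> ?I x y"
          using tri[of x z t] tri[of x t y] less.prems z(1) eq by auto
      qed
      have "x \<in> ?I x y" using zero less.prems by simp
      moreover have "x \<notin> ?I z y" using pos[of z x] z less.prems eq by auto
      ultimately show "?I z y \<noteq> ?I x y" by blast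
    qed
    then have 2: "P z y" using less.hyps[of z y] less.prems z fin by (simp add: psubset_card_mono)
    show ?thesis using split[OF less.prems z(1) eq 1 2] .
  qed
qed

text \<open>Opposite sides of a 4-cycle, oriented in parallel, are projective by a sequence with
  \<open>m = 1\<close>.\<close>

lemma directed_orbit_invariant_four_cycle:
  assumes inv: "directed_orbit_invariant T \<mu>"
    and cyc: "four_cycle (underlying_graph T \<mu>) a b c e"
  shows "\<mu> (a, b) = \<mu> (e, c)"
proof -
  let ?G = "underlying_graph T \<mu>" and ?R = "{(e, e'). projective (underlying_graph T \<mu>) e e'}"
  have ed: "(a, b) \<in> oriented_edges ?G" "(e, c) \<in> oriented_edges ?G"
    using cyc unfolding four_cycle_def oriented_edges_def by (auto simp: insert_commute)
  have "projective ?G (a, b) (e, c)"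
    unfolding projective_def using cyc ed
    by (intro exI[of _ 1] exI[of _ "\<lambda>i. if i = 0 then a else e"] exI[of _ "\<lambda>i. if i = 0 then b else c"])
      auto
  then have ec: "(e, c) \<in> ?R `` {(a, b)}" by simp
  have ab: "(a, b) \<in> ?R `` {(a, b)}" using equiv_class_self[OF equiv_projective ed(1)] .
  have "?R `` {(a, b)} \<in> directed_orbits ?G"
    unfolding directed_orbits_def using ed(1) by (rule quotientI)
  with inv have "\<forall>f\<in>?R `` {(a, b)}. \<forall>f'\<in>?R `` {(a, b)}. \<mu> f = \<mu> f'"
    unfolding directed_orbit_invariant_def by (rule bspec)
  from bspec[OF bspec[OF this ab] ec] show ?thesis .
qed

section \<open>From lattice diamonds to submodularity\<close>

lemma (in modular_lattice) four_cycle_covering_graph: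
  assumes "covers L r p" "covers L s p" "r \<noteq> s"
  shows "four_cycle (covering_graph L) p r (r \<squnion> s) s"
proof -
  have rs: "covers L (r \<squnion> s) s" "covers L (r \<squnion> s) r"
    using covers_join_if_upper_covers(1) assms join_comm by metis+
  then have "p \<noteq> r \<squnion> s" using assms(1) le_antisym unfolding covers_iff by blast
  moreover have "p \<noteq> r" "p \<noteq> s" "r \<noteq> r \<squnion> s" "s \<noteq> r \<squnion> s"
    using assms rs unfolding covers_iff by simp_all
  ultimately have "distinct [p, r, r \<squnion> s, s]" using assms(3) by auto
  moreover have "{a, b} \<in> snd (covering_graph L)" "{b, a} \<in> snd (covering_graph L)"
    if "covers L b a" for a b
    using that unfolding covering_graph_def by auto
  ultimately show ?thesis using assms rs unfolding four_cycle_def by simp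
qed

lemma (in modular_lattice) submodular_on_prod_order_if_directed_orbit_invariant:
  fixes \<mu> :: "'a \<times> 'a \<Rightarrow> real"
  assumes fin: "finite (carrier L)"
    and met: "directed_metric (carrier L) \<mu>"
    and graph: "underlying_graph (carrier L) \<mu> = covering_graph L"
    and inv: "directed_orbit_invariant (carrier L) \<mu>"
  shows "submodular_on (prod_order L L) \<mu>"
proof -
  have nonneg: "\<mu> (x, y) \<ge> 0" and zero: "\<mu> (x, x) = 0"
    if "x \<in> carrier L" "y \<in> carrier L" for x y
    using met that unfolding directed_metric_def by auto
  have tri: "\<mu> (x, z) \<le> \<mu> (x, y) + \<mu> (y, z)"
    if "x \<in> carrier L" "y \<in> carrier L" "z \<in> carrier L" for x y z
    using met that unfolding directed_metric_def by auto
  have up: "\<mu> (p, r) = \<mu> (s, r \<squnion> s)" and down: "\<mu> (r, p) = \<mu> (r \<squnion> s, s)"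
    if "covers L r p" "covers L s p" "r \<noteq> s" for p r s
  proof -
    have cyc: "four_cycle (underlying_graph (carrier L) \<mu>) p r (r \<squnion> s) s"
      using four_cycle_covering_graph[OF that] graph by simp
    \<comment> \<open>The same cycle read from \<open>r\<close> in the other direction pairs the two
      downward edges.\<close>
    then have "four_cycle (underlying_graph (carrier L) \<mu>) r p s (r \<squnion> s)"
      unfolding four_cycle_def by (auto simp: insert_commute)
    with cyc show "\<mu> (p, r) = \<mu> (s, r \<squnion> s)" "\<mu> (r, p) = \<mu> (r \<squnion> s, s)"
      using directed_orbit_invariant_four_cycle[OF inv] by blast+
  qed
  obtain u where u: "\<And>a b. covers L b a \<Longrightarrow> u b = u a + \<mu> (a, b)"
    and umod: "\<And>x y. \<lbrakk>x \<in> carrier L; y \<in> carrier L\<rbrakk> \<Longrightarrow> u x + u y = u (x \<squnion> y) + u (x \<sqinter> y)"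
    using ex_valuation_if_diamond_invariant[OF fin, of "\<lambda>a b. \<mu> (a, b)"] up by blast
  obtain d where d: "\<And>a b. covers L b a \<Longrightarrow> d b = d a + \<mu> (b, a)"
    and dmod: "\<And>x y. \<lbrakk>x \<in> carrier L; y \<in> carrier L\<rbrakk> \<Longrightarrow> d x + d y = d (x \<squnion> y) + d (x \<sqinter> y)"
    using ex_valuation_if_diamond_invariant[OF fin, of "\<lambda>a b. \<mu> (b, a)"] down by blast
  define v where "v x = u x + d x" for x
  have vmod: "v x + v y = v (x \<squnion> y) + v (x \<sqinter> y)" if "x \<in> carrier L" "y \<in> carrier L" for x y
    using umod[OF that] dmod[OF that] unfolding v_def by simp
  have vmono: "v x \<le> v y" if "x \<in> carrier L" "y \<in> carrier L" "x \<sqsubseteq> y" for x y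
  proof (rule valuation_mono[OF fin _ that])
    show "v a \<le> v b" if "covers L b a" for a b
      using u[OF that] d[OF that] nonneg[of a b] nonneg[of b a] that
      unfolding v_def covers_iff by simp
  qed
  \<comment> \<open>The triangle inequality along a maximal chain, traversed upward for
    \<open>u\<close> and downward for \<open>d\<close>.\<close>
  have climb: "\<mu> (x, y) \<le> u y - u x \<and> \<mu> (y, x) \<le> d y - d x"
    if xy: "x \<in> carrier L" "y \<in> carrier L" "x \<sqsubseteq> y" for x y
    using fin xy
  proof (induction rule: le_covers_induct)
    case base
    show ?case using zero xy by simp
  next
    case (step c e)
    have "c \<in> carrier L" "e \<in> carrier L" using step unfolding covers_iff by auto
    then show ?case
      using u[OF step(1)] d[OF step(1)] step(4) tri[of x c e] tri[of e c x] xy by simp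
  qed
  \<comment> \<open>Regrouped so that only the \<open>v\<close> term depends on both arguments;
    inequalities for \<open>F\<close> thus reduce to inequalities for \<open>v\<close> at
    joins.\<close>
  define F where "F x y = v (x \<squnion> y) - u x - d y" for x y
  have le_F: "\<mu> (x, y) \<le> F x y" if "x \<in> carrier L" "y \<in> carrier L" for x y
    using tri[of x "x \<squnion> y" y] climb[of x "x \<squnion> y"] climb[of y "x \<squnion> y"] that
    unfolding F_def v_def by (simp add: join_left join_right)
  have F_tri: "F x z \<le> F x y + F y z"
    if "x \<in> carrier L" "y \<in> carrier L" "z \<in> carrier L" for x y z
  proof -
    have "x \<squnion> z \<sqsubseteq> (x \<squnion> y) \<squnion> (y \<squnion> z)"
      using that by (intro join_le) (simp_all add: le_joinI1 le_joinI2)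
    \<comment> \<open>Here \<open>q\<close> is \<open>y\<close>, and \<open>v y\<close> is just the
      \<open>u y + d y\<close> lost in passing through \<open>y\<close>.\<close>
    then have "v (x \<squnion> z) + v y \<le> v (x \<squnion> y) + v (y \<squnion> z)"
      using that by (intro valuation_sum_le[OF vmono vmod]) (auto simp: join_left join_right)
    then show ?thesis unfolding F_def v_def by simp
  qed
  have join_absorb: "a \<squnion> b = b" "b \<squnion> a = b" if "a \<in> carrier L" "b \<in> carrier L" "a \<sqsubseteq> b" for a b
    using that by (auto intro!: le_antisym join_le join_left join_right)
  \<comment> \<open>On edges one of the two legs is trivial and the other is an increment of
    \<open>u\<close> or \<open>d\<close>; on splits \<open>\<mu>\<close> is additive while
    \<open>F\<close> is subadditive.\<close>
  have F_le: "F x y \<le> \<mu> (x, y)" if "x \<in> carrier L" "y \<in> carrier L" for x y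
    using fin met that
  proof (induction rule: underlying_graph_induct)
    case (refl x)
    then show ?case using zero join_absorb[of x x] by (simp add: F_def v_def)
  next
    case (edge x y)
    then have "covers L x y \<or> covers L y x"
      unfolding graph covering_graph_def by (auto simp: doubleton_eq_iff)
    then show ?case
    proof
      assume c: "covers L x y"
      then have "x \<squnion> y = x" using join_absorb[of y x] unfolding covers_iff by blast
      then show ?thesis using d[OF c] by (simp add: F_def v_def)
    next
      assume c: "covers L y x"
      then have "x \<squnion> y = y" using join_absorb[of x y] unfolding covers_iff by blast
      then show ?thesis using u[OF c] by (simp add: F_def v_def)
    qed
  next
    case (split x y z)
    then show ?case using F_tri[of x z y] by simp
  qed
  have \<mu>: "\<mu> (x, y) = F x y" if "x \<in> carrier L" "y \<in> carrier L" for x y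
    using le_F[OF that] F_le that by (simp add: order_antisym)
  have "\<mu> (x \<squnion> x', y \<squnion> y') + \<mu> (x \<sqinter> x', y \<sqinter> y') \<le> \<mu> (x, y) + \<mu> (x', y')"
    if c: "x \<in> carrier L" "y \<in> carrier L" "x' \<in> carrier L" "y' \<in> carrier L" for x y x' y'
  proof -
    have "(x \<squnion> x') \<squnion> (y \<squnion> y') \<sqsubseteq> (x \<squnion> y) \<squnion> (x' \<squnion> y')"
      using c by (intro join_le) (simp_all add: le_joinI1 le_joinI2)
    moreover have "(x \<sqinter> x') \<squnion> (y \<sqinter> y') \<sqsubseteq> x \<squnion> y" "(x \<sqinter> x') \<squnion> (y \<sqinter> y') \<sqsubseteq> x' \<squnion> y'"
      using c by (auto intro!: join_le simp: le_joinI1 le_joinI2 meet_left meet_right)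
    ultimately have "v ((x \<squnion> x') \<squnion> (y \<squnion> y')) + v ((x \<sqinter> x') \<squnion> (y \<sqinter> y')) \<le> v (x \<squnion> y) + v (x' \<squnion> y')"
      using c by (intro valuation_sum_le[OF vmono vmod]) auto
    \<comment> \<open>Modularity of \<open>u\<close> in the first and of \<open>d\<close> in the
      second coordinate cancels all terms outside \<open>v\<close>.\<close>
    then show ?thesis using c umod[of x x'] dmod[of y y'] by (simp add: \<mu> F_def)
  qed
  then show ?thesis
    unfolding submodular_on_def
    using join_prod_order[OF lattice_axioms lattice_axioms]
      meet_prod_order[OF lattice_axioms lattice_axioms]
    by (auto simp: prod_order_def)
qed

theorem theorem4p1:
  fixes T :: "'a set" and \<mu> :: "'a \<times> 'a \<Rightarrow> real" and L :: "'a gorder"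
  assumes "finite T"
    and "directed_metric T \<mu>"
    and "modular_lattice L"
    and "carrier L = T"
    and "underlying_graph T \<mu> = covering_graph L"
    and "directed_orbit_invariant T \<mu>"
  shows "submodular_on (prod_order L L) \<mu>"
  using modular_lattice.submodular_on_prod_order_if_directed_orbit_invariant[OF assms(3)]
    assms(1,2,4-6)
  by simp

end
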